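(* Let $\xi$ be an irrational real number, and let $(p_k/q_k)_{k\ge0}$ be the sequence of convergents of $\xi$. Let $\mathbf{y}=\begin{pmatrix} y_1 \\ y_2 \end{pmatrix}\in\mathbb{R}^2$ (with $y_2\ne0$) be a point having rational slope $y_1/y_2=a/b$, where $a$ and $b$ are coprime integers with $|a|\le b$, and let $k$ be a positive integer such that $q_k\ge 12b/|y_2|$. Then, for any $\gamma\in\mathrm{SL}(2,\mathbb{Z})$ with norm $$|\gamma|\le\frac{|y_2|}{4}\,q_kq_{k+1},$$ we have the lower bound $$\left|\gamma\begin{pmatrix} \xi \\ 1 \end{pmatrix}-\mathbf{y}\right|\ge\frac{1}{4b\,q_k}.$$
   Context: For $\mathbf{z}=\begin{pmatrix} z_1 \\ z_2 \end{pmatrix}\in\mathbb{R}^2$, $|\mathbf{z}|=\max(|z_1|,|z_2|)$. For a matrix $\gamma$, $|\gamma|$ is the maximum of the absolute values of its entries. The convergents $p_k/q_k$ are the usual continued fraction convergents in lowest terms with $q_k>0$, indexed so that $p_0=\lfloor\xi\rfloor$, $q_0=1$. *)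

theory Defs
  imports "HOL-Analysis.Analysis"
begin

text \<open>
  Simple continued fraction expansion of an irrational \<open>x\<close>: the complete quotients are
  \<open>x\<^sub>0 = x\<close> and \<open>x\<^sub>k\<^sub>+\<^sub>1 = 1 / (x\<^sub>k - \<lfloor>x\<^sub>k\<rfloor>)\<close>, the partial quotients are \<open>a\<^sub>k = \<lfloor>x\<^sub>k\<rfloor>\<close>.
  For rational \<open>x\<close> the expansion terminates and the values past that point are junk.
\<close>

fun complete_quotient :: "real \<Rightarrow> nat \<Rightarrow> real" where
  "complete_quotient x 0 = x"
| "complete_quotient x (Suc k) = 1 / frac (complete_quotient x k)"

definition partial_quotient :: "real \<Rightarrow> nat \<Rightarrow> int" where
  "partial_quotient x k = \<lfloor>complete_quotient x k\<rfloor>"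

fun conv_num :: "real \<Rightarrow> nat \<Rightarrow> int" where
  "conv_num x 0 = partial_quotient x 0"
| "conv_num x (Suc 0) = partial_quotient x 1 * partial_quotient x 0 + 1"
| "conv_num x (Suc (Suc k)) =
     partial_quotient x (Suc (Suc k)) * conv_num x (Suc k) + conv_num x k"

fun conv_denom :: "real \<Rightarrow> nat \<Rightarrow> int" where
  "conv_denom x 0 = 1"
| "conv_denom x (Suc 0) = partial_quotient x 1"
| "conv_denom x (Suc (Suc k)) =
     partial_quotient x (Suc (Suc k)) * conv_denom x (Suc k) + conv_denom x k"

text \<open>
  The recurrences produce the truncated continued fractions
  \<open>[a\<^sub>0; a\<^sub>1, \<dots>, a\<^sub>k]\<close> in lowest terms with positive denominators.
\<close>

fun cfrac_trunc :: "real \<Rightarrow> nat \<Rightarrow> real" where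
  "cfrac_trunc x 0 = of_int \<lfloor>x\<rfloor>"
| "cfrac_trunc x (Suc k) = of_int \<lfloor>x\<rfloor> + 1 / cfrac_trunc (1 / frac x) k"

lemma inverse_frac_irrational:
  assumes "x \<notin> \<rat>"
  shows "1 / frac x \<notin> \<rat>"
proof
  assume "1 / frac x \<in> \<rat>"
  then have "1 / (1 / frac x) \<in> \<rat>" by (rule Rats_divide[OF Rats_1])
  then have "frac x + of_int \<lfloor>x\<rfloor> \<in> \<rat>" by (simp only: divide_divide_eq_right mult_1 div_by_1 Rats_add Rats_of_int)
  then show False using assms by (simp add: frac_def)
qed

lemma complete_quotient_irrational:
  "x \<notin> \<rat> \<Longrightarrow> complete_quotient x k \<notin> \<rat>"
  by (induction k) (simp_all only: complete_quotient.simps inverse_frac_irrational not_False_eq_True)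

lemma partial_quotient_pos:
  assumes "x \<notin> \<rat>"
  shows "partial_quotient x (Suc k) \<ge> 1"
proof -
  let ?y = "complete_quotient x k"
  have "?y \<notin> \<int>"
    using complete_quotient_irrational[OF assms] Ints_subset_Rats by blast
  then have "0 < frac ?y" "frac ?y < 1" by (auto simp: frac_lt_1)
  then have "1 \<le> 1 / frac ?y" by simp
  then show ?thesis by (simp add: partial_quotient_def)
qed

lemma conv_denom_pos:
  assumes "x \<notin> \<rat>"
  shows "conv_denom x k > 0"
proof -
  have "conv_denom x k > 0 \<and> conv_denom x (Suc k) > 0"
  proof (induction k)
    case 0
    show ?case using partial_quotient_pos[OF assms, of 0] by auto
  next
    case (Suc k)
    then have "0 < partial_quotient x (Suc (Suc k)) * conv_denom x (Suc k)"
      using partial_quotient_pos[OF assms, of "Suc k"] by (intro mult_pos_pos) auto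
    with Suc show ?case by simp
  qed
  then show ?thesis ..
qed

lemma conv_det:
  "conv_num x (Suc k) * conv_denom x k - conv_num x k * conv_denom x (Suc k) = (-1) ^ k"
  by (induction k) (simp_all add: algebra_simps)

lemma conv_coprime: "coprime (conv_num x k) (conv_denom x k)"
proof (rule coprimeI)
  fix d assume "d dvd conv_num x k" "d dvd conv_denom x k"
  then have "d dvd (-1) ^ k"
    by (subst conv_det[of x k, symmetric]) (intro dvd_diff dvd_mult dvd_mult2)
  then show "is_unit d"
    using dvd_trans[of d "(-1) ^ k" 1] by (simp add: is_unit_power_iff)
qed

lemma partial_quotient_shift:
  "partial_quotient x (Suc k) = partial_quotient (1 / frac x) k"
proof -
  have "complete_quotient x (Suc k) = complete_quotient (1 / frac x) k"
    by (induction k) simp_all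
  then show ?thesis by (simp only: partial_quotient_def)
qed

lemma conv_shift:
  "conv_num x (Suc k) = \<lfloor>x\<rfloor> * conv_num (1 / frac x) k + conv_denom (1 / frac x) k \<and>
   conv_denom x (Suc k) = conv_num (1 / frac x) k"
proof (induction k rule: less_induct)
  case (less k)
  have a0: "partial_quotient x 0 = \<lfloor>x\<rfloor>" by (simp add: partial_quotient_def)
  consider "k = 0" | "k = 1" | j where "k = Suc (Suc j)"
    by (metis One_nat_def not0_implies_Suc)
  then show ?case
  proof cases
    case 3
    then show ?thesis using less[of j] less[of "Suc j"]
      by (simp add: partial_quotient_shift algebra_simps)
  qed (simp_all add: a0 partial_quotient_shift algebra_simps)
qed

lemma conv_eq_cfrac_trunc:
  assumes "x \<notin> \<rat>"
  shows "of_int (conv_num x k) / of_int (conv_denom x k) = cfrac_trunc x k"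
  using assms
proof (induction k arbitrary: x)
  case 0
  show ?case by (simp add: partial_quotient_def)
next
  case (Suc k)
  let ?y = "1 / frac x"
  have "conv_num ?y k > 0"
    using conv_denom_pos[OF Suc.prems, of "Suc k"] conv_shift[of x k] by simp
  then show ?case
    using Suc.IH[OF inverse_frac_irrational[OF Suc.prems], symmetric] conv_shift[of x k]
    by (simp add: field_simps)
qed

text \<open>
  The maximum norm of a vector and of a matrix is the library's \<open>infnorm\<close>. For vectors in
  \<open>real^2\<close> see \<open>infnorm_2\<close>; the canonical basis of \<open>real^'n^'m\<close> consists of the matrix units, so for
  matrices one gets the following.
\<close>

lemma infnorm_matrix:
  fixes A :: "real^'n^'m"
  shows "infnorm A = Max {\<bar>A $ i $ j\<bar> | i j. True}"
proof -
  have eq: "{\<bar>A $ i $ j\<bar> | i j. True} = (\<lambda>(i, j). \<bar>A $ i $ j\<bar>) ` UNIV" by auto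
  have "infnorm A = Sup {\<bar>A $ i $ j\<bar> | i j. True}"
    unfolding infnorm_def
    by (rule arg_cong[where f = Sup]) (force simp: Basis_vec_def inner_axis)
  also have "\<dots> = Max {\<bar>A $ i $ j\<bar> | i j. True}"
    unfolding eq by (rule cSup_eq_Max) auto
  finally show ?thesis .
qed

end

theory Submission
  imports Defs
begin

text \<open>
  Let \<open>x = \<gamma> (\<xi>, 1)\<close> be too close to \<open>y\<close>, and put \<open>(m, n) = (b, -a) \<gamma>\<close>, a primitive integer
  vector. Since \<open>b y\<^sub>1 = a y\<^sub>2\<close>, the linear form \<open>m \<xi> + n = b x\<^sub>1 - a x\<^sub>2\<close> is below \<open>1 / (2 q\<^sub>k)\<close> in
  absolute value, while the second row of \<open>\<gamma>\<inverse> x = (\<xi>, 1)\<close> and the bound on \<open>\<gamma>\<close> give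
  \<open>\<bar>m\<bar> \<le> q\<^sub>k / 12 + q\<^sub>k\<^sub>+\<^sub>1 / 8\<close>. Hence the integer \<open>q\<^sub>k n + p\<^sub>k m = q\<^sub>k (m \<xi> + n) - m (q\<^sub>k \<xi> - p\<^sub>k)\<close>
  has absolute value below 1, so it vanishes and \<open>(m, n) = \<plusminus>(q\<^sub>k, -p\<^sub>k)\<close>. But then
  \<open>b = x\<^sub>2 m - \<gamma>\<^sub>2\<^sub>1 (m \<xi> + n)\<close> forces \<open>\<bar>\<gamma>\<^sub>2\<^sub>1\<bar>\<close> to be of size at least \<open>(3/4) \<bar>y\<^sub>2\<bar> q\<^sub>k q\<^sub>k\<^sub>+\<^sub>1\<close>,
  which exceeds the bound.
\<close>

text \<open>The errors obey the same three-term recurrence as the convergents. By induction the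
  older error is \<open>- ?c (Suc (Suc k))\<close> times the newer one, so the new coefficient is
  partial minus complete quotient, i.e. minus the fractional part.\<close>

lemma conv_error_Suc:
  assumes "x \<notin> \<rat>"
  shows "of_int (conv_denom x (Suc k)) * x - of_int (conv_num x (Suc k)) =
    - frac (complete_quotient x (Suc k)) * (of_int (conv_denom x k) * x - of_int (conv_num x k))"
proof (induction k)
  case 0
  have "frac x \<noteq> 0"
    using assms Ints_subset_Rats by auto
  then show ?case
    by (simp add: partial_quotient_def frac_def field_simps)
next
  case (Suc k)
  let ?D = "\<lambda>j. of_int (conv_denom x j) * x - of_int (conv_num x j)"
  let ?c = "complete_quotient x"
  have "?c (Suc k) \<notin> \<int>"
    using complete_quotient_irrational[OF assms, of "Suc k"] Ints_subset_Rats by blast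
  then have nz: "frac (?c (Suc k)) \<noteq> 0"
    by simp
  have quot: "?c (Suc (Suc k)) = 1 / frac (?c (Suc k))"
    by (rule complete_quotient.simps)
  have IH: "?D (Suc k) = - frac (?c (Suc k)) * ?D k"
    by (rule Suc.IH)
  have D: "?D k = - ?c (Suc (Suc k)) * ?D (Suc k)"
    unfolding IH quot using nz by simp
  have "?D (Suc (Suc k)) = of_int (partial_quotient x (Suc (Suc k))) * ?D (Suc k) + ?D k"
    by (simp add: algebra_simps)
  also have "\<dots> = - frac (?c (Suc (Suc k))) * ?D (Suc k)"
    unfolding D by (simp add: partial_quotient_def frac_def algebra_simps del: complete_quotient.simps)
  finally show ?case .
qed

text \<open>Eliminating \<open>x\<close> from two consecutive errors leaves the determinant of
  \<open>conv_det\<close>, which is 1 or -1; the cofactor of \<open>D k\<close> is at least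
  \<open>conv_denom x (Suc k)\<close>.\<close>

lemma conv_error_le:
  assumes "x \<notin> \<rat>"
  shows "of_int (conv_denom x (Suc k)) * \<bar>of_int (conv_denom x k) * x - of_int (conv_num x k)\<bar> \<le> 1"
proof -
  define D where "D j = of_int (conv_denom x j) * x - of_int (conv_num x j)" for j
  define f where "f = frac (complete_quotient x (Suc k))"
  have err: "D (Suc k) = - f * D k"
    unfolding D_def f_def by (rule conv_error_Suc[OF assms])
  have f: "f \<ge> 0"
    by (simp add: f_def del: complete_quotient.simps)
  have q: "conv_denom x k > 0" "conv_denom x (Suc k) > 0"
    using assms by (rule conv_denom_pos)+
  have "D k * (of_int (conv_denom x (Suc k)) + of_int (conv_denom x k) * f) =
      of_int (conv_denom x (Suc k)) * D k - of_int (conv_denom x k) * D (Suc k)"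
    unfolding err by (simp add: algebra_simps del: conv_denom.simps)
  also have "\<dots> = of_int (conv_num x (Suc k) * conv_denom x k - conv_num x k * conv_denom x (Suc k))"
    by (simp add: D_def algebra_simps del: conv_num.simps conv_denom.simps)
  also have "\<dots> = (-1) ^ k"
    by (simp only: conv_det) simp
  finally have "\<bar>D k\<bar> * \<bar>of_int (conv_denom x (Suc k)) + of_int (conv_denom x k) * f\<bar> = 1"
    by (simp add: abs_mult[symmetric] del: conv_num.simps conv_denom.simps)
  moreover have "of_int (conv_denom x (Suc k)) \<le>
      \<bar>of_int (conv_denom x (Suc k)) + of_int (conv_denom x k) * f\<bar>"
    using f q by (intro order_trans[OF _ abs_ge_self]) simp
  ultimately show ?thesis
    unfolding D_def[symmetric] by (metis abs_ge_zero mult.commute mult_left_mono)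
qed

lemma conv_denom_mono_Suc:
  assumes "x \<notin> \<rat>"
  shows "conv_denom x k \<le> conv_denom x (Suc k)"
proof (cases k)
  case 0
  then show ?thesis
    using partial_quotient_pos[OF assms, of 0] by simp
next
  case (Suc j)
  have "1 * conv_denom x (Suc j) \<le> partial_quotient x (Suc (Suc j)) * conv_denom x (Suc j)"
    using partial_quotient_pos[OF assms, of "Suc j"] conv_denom_pos[OF assms, of "Suc j"]
    by (intro mult_right_mono) auto
  then show ?thesis
    using conv_denom_pos[OF assms, of j] unfolding Suc by simp
qed

lemma coprime_proportional_unit:
  fixes m n p q :: int
  assumes "coprime m n" "coprime p q" and eq: "q * n + p * m = 0"
  obtains s where "\<bar>s\<bar> = 1" "m = s * q" "n = - s * p"
proof (cases "q = 0")
  case True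
  then have "\<bar>p\<bar> = 1" "m = 0"
    using assms by auto
  moreover have "\<bar>n\<bar> = 1"
    using assms(1) \<open>m = 0\<close> by simp
  moreover have "p * p = 1"
    using \<open>\<bar>p\<bar> = 1\<close> abs_mult_self_eq[of p] by simp
  ultimately show ?thesis
    \<comment> \<open>Solves \<open>n = - s * p\<close> for \<open>s\<close>, since
      \<open>p * p = 1\<close>.\<close>
    using that[of "- n * p"] True by (simp add: abs_mult mult.assoc)
next
  case False
  have "q dvd p * m"
    using eq by (metis add.commute dvd_0_right dvd_add_right_iff dvd_triv_left)
  then have "q dvd m"
    using assms(2) by (simp add: coprime_commute coprime_dvd_mult_right_iff)
  then obtain s where m: "m = s * q"
    by (metis dvdE mult.commute)
  with eq have "q * (n + s * p) = 0"
    by (simp add: algebra_simps)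
  then have n: "n = - s * p"
    using False by simp
  have "s dvd m" "s dvd n"
    by (simp_all add: m n)
  then have "is_unit s"
    using assms(1) by (rule coprime_common_divisor[rotated])
  then show ?thesis
    using that m n by simp
qed

lemma abs_entry_le_infnorm:
  fixes A :: "real^'n^'m"
  shows "\<bar>A $ i $ j\<bar> \<le> infnorm A"
proof -
  have "{\<bar>A $ i $ j\<bar> | i j. True} = (\<lambda>(i, j). \<bar>A $ i $ j\<bar>) ` UNIV"
    by auto
  then show ?thesis
    unfolding infnorm_matrix by (intro Max_ge) auto
qed

text \<open>Applied to the error vector twice: with coefficients \<open>b\<close>, \<open>a\<close>
  to bound \<open>r\<close>, and with the first column of \<open>\<gamma>\<close> to bound
  \<open>m\<close>. Positivity of \<open>M\<close> keeps the inequality strict even for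
  \<open>u = v = 0\<close>.\<close>

lemma abs_lincomb_less:
  fixes u v r s e M :: real
  assumes "\<bar>r\<bar> < e" "\<bar>s\<bar> < e" "\<bar>u\<bar> \<le> M" "\<bar>v\<bar> \<le> M" "M > 0"
  shows "\<bar>u * r - v * s\<bar> < 2 * M * e"
proof -
  have "\<bar>u\<bar> * \<bar>r\<bar> \<le> M * \<bar>r\<bar>" "\<bar>v\<bar> * \<bar>s\<bar> \<le> M * \<bar>s\<bar>"
    using assms by (intro mult_right_mono; simp)+
  moreover have "M * \<bar>r\<bar> < M * e" "M * \<bar>s\<bar> < M * e"
    using assms by simp_all
  ultimately show ?thesis
    using abs_triangle_ineq4[of "u * r" "v * s"] unfolding abs_mult by linarith
qed

theorem theorem4:
  fixes \<xi> :: real and y :: "real^2" and a b :: int and k :: nat and \<gamma> :: "int^2^2"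
  assumes "\<xi> \<notin> \<rat>"
    and "y $ 2 \<noteq> 0"
    and "y $ 1 / y $ 2 = of_int a / of_int b"
    and "coprime a b"
    and "\<bar>a\<bar> \<le> b"
    and "k > 0"
    and "of_int (conv_denom \<xi> k) \<ge> 12 * of_int b / \<bar>y $ 2\<bar>"
    and "det \<gamma> = 1"
    and "infnorm (map_matrix real_of_int \<gamma>)
           \<le> \<bar>y $ 2\<bar> / 4 * of_int (conv_denom \<xi> k) * of_int (conv_denom \<xi> (Suc k))"
  shows "infnorm (map_matrix real_of_int \<gamma> *v vector [\<xi>, 1] - y)
           \<ge> 1 / (4 * of_int b * of_int (conv_denom \<xi> k))"
proof (rule ccontr)
  assume contra: "\<not> ?thesis"
  define p q Q :: int
    where "p = conv_num \<xi> k" and "q = conv_denom \<xi> k" and "Q = conv_denom \<xi> (Suc k)"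
  define \<epsilon> where "\<epsilon> = 1 / (4 * real_of_int b * of_int q)"
  define M where "M = \<bar>y $ 2\<bar> / 4 * of_int q * of_int Q"
  define v1 u1 v2 u2 where "v1 = \<gamma> $ 1 $ 1" and "u1 = \<gamma> $ 1 $ 2"
    and "v2 = \<gamma> $ 2 $ 1" and "u2 = \<gamma> $ 2 $ 2"
  define x1 x2 where "x1 = of_int v1 * \<xi> + of_int u1" and "x2 = of_int v2 * \<xi> + of_int u2"
  define m n where "m = b * v1 - a * v2" and "n = b * u1 - a * u2"
  define r where "r = of_int m * \<xi> + of_int n"
  define D where "D = of_int q * \<xi> - of_int p"

  have q: "q > 0" and Q: "Q > 0" and qQ: "q \<le> Q"
    using conv_denom_pos conv_denom_mono_Suc assms(1) by (simp_all only: q_def Q_def)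
  have "b \<noteq> 0"
    using \<open>coprime a b\<close> \<open>\<bar>a\<bar> \<le> b\<close> by auto
  with \<open>\<bar>a\<bar> \<le> b\<close> have b: "b > 0"
    by linarith
  have y2: "\<bar>y $ 2\<bar> > 0"
    using \<open>y $ 2 \<noteq> 0\<close> by simp
  have M: "M > 0"
    using y2 q Q by (simp add: M_def)
  have D: "of_int Q * \<bar>D\<bar> \<le> 1"
    unfolding D_def p_def q_def Q_def by (rule conv_error_le) fact
  have large: "12 * of_int b \<le> \<bar>y $ 2\<bar> * of_int q"
    using assms(7) y2 unfolding q_def[symmetric] by (simp add: field_simps)
  have slope: "of_int b * y $ 1 = of_int a * y $ 2"
    using assms(2,3) b by (simp add: field_simps)
  have det: "v1 * u2 - u1 * v2 = 1"
    using \<open>det \<gamma> = 1\<close> by (simp add: det_2 v1_def v2_def u1_def u2_def)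
  then have rdet: "real_of_int v1 * u2 - u1 * v2 = 1"
    by (metis of_int_1 of_int_diff of_int_mult)
  have entries: "\<bar>real_of_int (\<gamma> $ i $ j)\<bar> \<le> M" for i j
    using abs_entry_le_infnorm[of "map_matrix real_of_int \<gamma>" i j] assms(9)
    unfolding M_def q_def[symmetric] Q_def[symmetric] by (simp add: map_matrix_def)
  have comps: "(map_matrix real_of_int \<gamma> *v vector [\<xi>, 1] - y) $ 1 = x1 - y $ 1"
    "(map_matrix real_of_int \<gamma> *v vector [\<xi>, 1] - y) $ 2 = x2 - y $ 2"
    by (simp_all add: matrix_vector_mult_def sum_2 map_matrix_def x1_def x2_def
        v1_def v2_def u1_def u2_def)
  have close: "\<bar>x1 - y $ 1\<bar> < \<epsilon>" "\<bar>x2 - y $ 2\<bar> < \<epsilon>"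
    using contra unfolding infnorm_2 comps \<epsilon>_def q_def by simp_all

  \<comment> \<open>The form with coefficients \<open>b\<close>, \<open>-a\<close> vanishes at
    \<open>y\<close>, so only the error counts.\<close>
  have "r = of_int b * (x1 - y $ 1) - of_int a * (x2 - y $ 2)"
    using slope by (simp add: r_def m_def n_def x1_def x2_def algebra_simps)
  then have "\<bar>r\<bar> < 2 * of_int b * \<epsilon>"
    using abs_lincomb_less[OF close, of "of_int b" "of_int b" "of_int a"] b \<open>\<bar>a\<bar> \<le> b\<close>
    by simp
  then have r: "of_int q * \<bar>r\<bar> < 1 / 2"
    using b q by (simp add: \<epsilon>_def field_simps)

  \<comment> \<open>Replacing \<open>y\<close> by \<open>x1\<close>, \<open>x2\<close> turns the
    bracket into the determinant 1, up to an error.\<close>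
  have "y $ 2 * of_int m = of_int b * (of_int v1 * y $ 2 - of_int v2 * y $ 1)"
    using slope by (simp add: m_def algebra_simps)
  also have "\<dots> = of_int b * (1 - (of_int v1 * (x2 - y $ 2) - of_int v2 * (x1 - y $ 1)))"
    using rdet by (simp add: x1_def x2_def algebra_simps)
  finally have m_eq: "y $ 2 * of_int m = \<dots>" .
  have "\<bar>of_int v1 * (x2 - y $ 2) - of_int v2 * (x1 - y $ 1)\<bar> < 2 * M * \<epsilon>"
    using close entries M by (intro abs_lincomb_less) (simp_all add: v1_def v2_def)
  then have "\<bar>1 - (of_int v1 * (x2 - y $ 2) - of_int v2 * (x1 - y $ 1))\<bar> < 1 + 2 * M * \<epsilon>"
    by linarith
  then have "\<bar>y $ 2\<bar> * \<bar>of_int m\<bar> < of_int b * (1 + 2 * M * \<epsilon>)"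
    unfolding abs_mult[symmetric] m_eq using b by (simp add: abs_mult)
  also have "\<dots> = of_int b + \<bar>y $ 2\<bar> * of_int Q / 8"
    using b q by (simp add: M_def \<epsilon>_def field_simps)
  also have "\<dots> \<le> \<bar>y $ 2\<bar> * (of_int q / 12 + of_int Q / 8)"
    using large by (simp add: algebra_simps)
  finally have "\<bar>of_int m\<bar> < of_int q / 12 + real_of_int Q / 8"
    using y2 by simp
  \<comment> \<open>Here 5/24 = 1/12 + 1/8; below, 1/2 + 5/24 < 1 is what matters.\<close>
  then have m: "\<bar>of_int m\<bar> < of_int Q * (5 / 24 :: real)"
    using qQ by simp

  have "of_int (q * n + p * m) = of_int q * r - of_int m * D"
    by (simp add: r_def D_def algebra_simps)
  moreover have "\<bar>of_int m * D\<bar> \<le> 5 / 24 * (of_int Q * \<bar>D\<bar>)"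
    using m mult_right_mono[of "\<bar>of_int m\<bar>" "of_int Q * (5 / 24)" "\<bar>D\<bar>"]
    by (simp add: abs_mult)
  moreover have "\<bar>of_int q * r\<bar> < 1 / 2"
    using r q by (simp add: abs_mult)
  ultimately have "\<bar>real_of_int (q * n + p * m)\<bar> < 1"
    using D by linarith
  then have zero: "q * n + p * m = 0"
    by linarith
  \<comment> \<open>Multiplying \<open>(m, n)\<close> by the inverse of \<open>\<gamma>\<close>
    recovers \<open>(b, -a)\<close>, so a common divisor of \<open>m\<close> and \<open>n\<close>
    divides both \<open>a\<close> and \<open>b\<close>.\<close>
  have mu: "m * u2 - n * v2 = b"
    using det by (simp add: m_def n_def) algebra
  have mu': "m * u1 - n * v1 = a"
    using det by (simp add: m_def n_def) algebra
  have "coprime m n"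
  proof (rule coprimeI)
    fix d assume "d dvd m" "d dvd n"
    then have "d dvd a" "d dvd b"
      unfolding mu[symmetric] mu'[symmetric] by simp_all
    then show "is_unit d"
      using \<open>coprime a b\<close> by (meson coprime_common_divisor)
  qed
  moreover have "coprime p q"
    unfolding p_def q_def by (rule conv_coprime)
  ultimately obtain s where s: "\<bar>s\<bar> = 1" "m = s * q" "n = - s * p"
    using zero by (rule coprime_proportional_unit)
  have abs_m: "\<bar>real_of_int m\<bar> = of_int q"
    using s(1) q by (simp add: s(2) abs_mult flip: of_int_abs)
  have "r = of_int s * D"
    by (simp add: r_def D_def s algebra_simps)
  then have abs_r: "\<bar>r\<bar> = \<bar>D\<bar>"
    using s(1) by (simp add: abs_mult flip: of_int_abs)

  \<comment> \<open>The terms in \<open>\<xi>\<close> cancel, leaving the integer \<open>b\<close>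
    by \<open>mu\<close>.\<close>
  have "x2 * of_int m - of_int v2 * r = of_int (m * u2 - n * v2)"
    by (simp add: x2_def r_def algebra_simps)
  moreover have b1: "real_of_int b \<ge> 1"
    using b by simp
  ultimately have "\<bar>x2\<bar> * of_int q \<le> of_int b + \<bar>of_int v2\<bar> * \<bar>D\<bar>"
    unfolding mu abs_m[symmetric] abs_r[symmetric] abs_mult[symmetric] by linarith
  also have "\<bar>of_int v2\<bar> * \<bar>D\<bar> \<le> M * \<bar>D\<bar>"
    using entries by (intro mult_right_mono) (simp_all add: v2_def)
  also have "M * \<bar>D\<bar> = \<bar>y $ 2\<bar> / 4 * of_int q * (of_int Q * \<bar>D\<bar>)"
    by (simp add: M_def)
  also have "\<dots> \<le> \<bar>y $ 2\<bar> / 4 * of_int q * 1"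
    using D q by (intro mult_left_mono) auto
  finally have x2: "\<bar>x2\<bar> * of_int q \<le> of_int b + \<bar>y $ 2\<bar> * of_int q / 4"
    by simp
  have "\<epsilon> * of_int q \<le> 1 / 4"
    using b q by (simp add: \<epsilon>_def field_simps)
  moreover have "\<bar>y $ 2\<bar> * of_int q \<le> (\<bar>x2\<bar> + \<epsilon>) * of_int q"
    using close(2) q by (intro mult_right_mono) auto
  ultimately have "\<bar>y $ 2\<bar> * of_int q \<le> \<bar>x2\<bar> * of_int q + 1 / 4"
    by (simp add: algebra_simps)
  \<comment> \<open>With t = \<open>\<bar>y $ 2\<bar> * of_int q\<close> the bounds give 3t/4 \<le>
    b + 1/4, whereas t \<ge> 12b gives 3t/4 \<ge> 9b, impossible for b \<ge> 1.\<close>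
  then show False
    using x2 large b1 by linarith
qed

end
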